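(* Let $1\le p\le\infty$ and let $f\in L_p[0,1]$ be a self-similar function of zero spectral order. Then $f$ is piecewise constant and takes at most countably many values. All points of discontinuity of $f$ are discontinuities of the first kind, except possibly for one point. (As $f$ is an element of $L_p[0,1]$, this means that $f$ has a representative with these properties.)
   Context: Similarity operators. Fix an integer $n>1$, real numbers $a_k>0$ ($k=1,\dots,n$) with $\sum_{k=1}^n a_k=1$, and real numbers $d_k,\beta_k$ ($k=1,\dots,n$). Put $\alpha_1=0$ and $\alpha_k=\sum_{l=1}^{k-1}a_l$ for $k=2,\dots,n+1$, so that $0=\alpha_1<\alpha_2<\dots<\alpha_n<\alpha_{n+1}=1$. For $f\in L_p[0,1]$ and $x\in[\alpha_k,\alpha_{k+1}]$ put $G_k(f)(x)=f\big((x-\alpha_k)/a_k\big)$ (orientation preserving) and $\tilde G_k(f)(x)=f\big((\alpha_{k+1}-x)/a_k\big)$ (orientation reversing); both are regarded as zero outside $[\alpha_k,\alpha_{k+1}]$. For each $k$ let $\hat G_k$ be either $G_k$ or $\tilde G_k$. The similarity operator $G:L_p[0,1]\to L_p[0,1]$ is $$G(f)=\sum_{k=1}^n\left\{\beta_k\,\chi_{(\alpha_k,\alpha_{k+1})}+d_k\,\hat G_k(f)\right\},$$ where $\chi$ denotes a characteristic function. Standing assumptions. $G$ is a contraction in $L_p[0,1]$: $\sum_{k=1}^n a_k|d_k|^p<1$ if $1\le p<\infty$, respectively $\max_k|d_k|<1$ if $p=\infty$. At least one of the $\beta_k$ is nonzero. A function $f\in L_p[0,1]$ is self-similar if $G(f)=f$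 for such a $G$ (the fixed point is unique). It is called a self-similar function of zero spectral order if exactly one of the numbers $d_1,\dots,d_n$ is nonzero. Piecewise constant means: constant on each of at most countably many pairwise disjoint open intervals whose union has countable complement in $[0,1]$. A point of discontinuity is of the first kind if the one-sided limits there (only one of them at an endpoint of $[0,1]$) exist and are finite. *)

theory Defs
  imports "HOL-Analysis.Analysis"
begin

text \<open>Elements of \<open>L\<^sub>p[0,1]\<close> are handled through representatives \<open>f :: real \<Rightarrow> real\<close>; only
  the values on \<open>[0,1]\<close> matter, and equality in \<open>L\<^sub>p\<close> is equality almost everywhere on \<open>[0,1]\<close>.\<close>

definition mem_Lp :: "ennreal \<Rightarrow> (real \<Rightarrow> real) \<Rightarrow> bool" where
  "mem_Lp p f \<longleftrightarrow>
     f \<in> borel_measurable (lebesgue_on {0..1}) \<and>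
     (if p = \<infinity> then \<exists>C. AE x in lebesgue_on {0..1}. \<bar>f x\<bar> \<le> C
      else integrable (lebesgue_on {0..1}) (\<lambda>x. \<bar>f x\<bar> powr enn2real p))"

definition eq_Lp :: "(real \<Rightarrow> real) \<Rightarrow> (real \<Rightarrow> real) \<Rightarrow> bool" where
  "eq_Lp f g \<longleftrightarrow> (AE x in lebesgue_on {0..1}. f x = g x)"

text \<open>Families indexed by \<open>k = 1, \<dots>, n\<close> are functions on \<open>nat\<close> whose values outside \<open>{1..n}\<close>
  are never used.\<close>

definition breakpoint :: "(nat \<Rightarrow> real) \<Rightarrow> nat \<Rightarrow> real" where
  "breakpoint a k = (\<Sum>l\<in>{1..<k}. a l)"

definition G_pres :: "(nat \<Rightarrow> real) \<Rightarrow> nat \<Rightarrow> (real \<Rightarrow> real) \<Rightarrow> real \<Rightarrow> real" where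
  "G_pres a k f x =
     (if x \<in> {breakpoint a k..breakpoint a (k + 1)}
      then f ((x - breakpoint a k) / a k) else 0)"

definition G_rev :: "(nat \<Rightarrow> real) \<Rightarrow> nat \<Rightarrow> (real \<Rightarrow> real) \<Rightarrow> real \<Rightarrow> real" where
  "G_rev a k f x =
     (if x \<in> {breakpoint a k..breakpoint a (k + 1)}
      then f ((breakpoint a (k + 1) - x) / a k) else 0)"

text \<open>\<open>flip k\<close> says that the orientation-reversing operator is used on the \<open>k\<close>-th interval.\<close>

definition similarity_op ::
  "nat \<Rightarrow> (nat \<Rightarrow> real) \<Rightarrow> (nat \<Rightarrow> real) \<Rightarrow> (nat \<Rightarrow> real) \<Rightarrow> (nat \<Rightarrow> bool)
    \<Rightarrow> (real \<Rightarrow> real) \<Rightarrow> real \<Rightarrow> real" where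
  "similarity_op n a d \<beta> flip f x =
     (\<Sum>k = 1..n. \<beta> k * indicator {breakpoint a k<..<breakpoint a (k + 1)} x
        + d k * (if flip k then G_rev a k f x else G_pres a k f x))"

definition contraction_cond :: "ennreal \<Rightarrow> nat \<Rightarrow> (nat \<Rightarrow> real) \<Rightarrow> (nat \<Rightarrow> real) \<Rightarrow> bool" where
  "contraction_cond p n a d \<longleftrightarrow>
     (if p = \<infinity> then Max ((\<lambda>k. \<bar>d k\<bar>) ` {1..n}) < 1
      else (\<Sum>k = 1..n. a k * \<bar>d k\<bar> powr enn2real p) < 1)"

definition similarity_params ::
  "ennreal \<Rightarrow> nat \<Rightarrow> (nat \<Rightarrow> real) \<Rightarrow> (nat \<Rightarrow> real) \<Rightarrow> (nat \<Rightarrow> real) \<Rightarrow> bool" where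
  "similarity_params p n a d \<beta> \<longleftrightarrow>
     n > 1 \<and> (\<forall>k\<in>{1..n}. a k > 0) \<and> (\<Sum>k = 1..n. a k) = 1 \<and>
     contraction_cond p n a d \<and> (\<exists>k\<in>{1..n}. \<beta> k \<noteq> 0)"

definition self_similar_zero_order :: "ennreal \<Rightarrow> (real \<Rightarrow> real) \<Rightarrow> bool" where
  "self_similar_zero_order p f \<longleftrightarrow>
     mem_Lp p f \<and>
     (\<exists>n a d \<beta> flip. similarity_params p n a d \<beta> \<and>
        eq_Lp (similarity_op n a d \<beta> flip f) f \<and>
        (\<exists>!k. k \<in> {1..n} \<and> d k \<noteq> 0))"

definition piecewise_constant :: "(real \<Rightarrow> real) \<Rightarrow> bool" where
  "piecewise_constant g \<longleftrightarrow>
     (\<exists>\<I>. countable \<I> \<and> disjoint \<I> \<and>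
        (\<forall>I\<in>\<I>. I \<subseteq> {0..1} \<and> (\<exists>u v. u < v \<and> I = {u<..<v}) \<and> g constant_on I) \<and>
        countable ({0..1} - \<Union>\<I>))"

definition discontinuity :: "(real \<Rightarrow> real) \<Rightarrow> real \<Rightarrow> bool" where
  "discontinuity g x \<longleftrightarrow> x \<in> {0..1} \<and> \<not> continuous (at x within {0..1}) g"

definition discontinuity_first_kind :: "(real \<Rightarrow> real) \<Rightarrow> real \<Rightarrow> bool" where
  "discontinuity_first_kind g x \<longleftrightarrow>
     discontinuity g x \<and>
     (x > 0 \<longrightarrow> (\<exists>l. (g \<longlongrightarrow> l) (at_left x))) \<and>
     (x < 1 \<longrightarrow> (\<exists>r. (g \<longlongrightarrow> r) (at_right x)))"

end

theory Submission
  imports Defs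
begin

text \<open>
  Let \<open>F\<close> be \<open>f\<close> extended by zero to the real line, and let \<open>m\<close> be the only index with
  \<open>d m \<noteq> 0\<close>. Call a point bad if, on at least one of its two sides, \<open>F\<close> is not almost everywhere
  constant close to the point. The proof consists of two independent observations.

  There is at most one bad point (\<open>zero_order_const_germs\<close>). On the open cell number \<open>k\<close> of the
  partition, the equation \<open>G f = f\<close> reads \<open>F = \<beta> k + d k * (F \<circ> T k)\<close> almost everywhere, where
  \<open>T k\<close> is the affine map that stretches the cell onto \<open>[0,1]\<close> (\<open>expansion a flip k\<close>). For \<open>k \<noteq> m\<close> the right-hand side
  is constant. So if \<open>x\<close> is bad, its bad side lies in cell \<open>m\<close>, and then \<open>T m x\<close> is bad as well: an
  affine change of variable carries one-sided neighbourhoods to one-sided neighbourhoods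
  (\<open>const_germ_affine\<close>). Hence \<open>T m\<close> maps the set of bad points, a subset of \<open>[0,1]\<close>, into itself.
  As \<open>n > 1\<close>, it multiplies all distances by \<open>1 / a m > 1\<close>, and a bounded set that is mapped into
  itself by such a map has at most one element (\<open>bounded_invariant_set_of_expansion\<close>).

  A function with at most one bad point \<open>c\<close> has the required representative
  (\<open>const_germs_imp_rep\<close>). Let \<open>U\<close> be the open set of points near which \<open>F\<close> is almost everywhere
  equal to a constant; the representative takes this constant as its value, and it is \<open>0\<close> outside
  \<open>U\<close>. It is constant on each of the countably many components of \<open>U\<close>. Each \<open>x \<noteq> c\<close> has a
  punctured neighbourhood inside \<open>U\<close>, so the complement of \<open>U\<close> has no accumulation point other than
  \<open>c\<close> and is countable, and on either side of \<open>x\<close> the representative is constant close to \<open>x\<close>.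
\<close>

section \<open>One-sided germs that are almost everywhere constant\<close>

text \<open>
  The sign of \<open>s \<noteq> 0\<close> selects the side of \<open>x\<close>: right if \<open>s > 0\<close>, left if \<open>s < 0\<close>. The size of
  \<open>s\<close> only rescales \<open>e\<close>. Keeping it arbitrary lets orientation preserving and reversing changes of
  variable be treated alike: a slope \<open>c\<close> turns \<open>s\<close> into \<open>s / c\<close>.
\<close>

definition const_germ :: "(real \<Rightarrow> real) \<Rightarrow> real \<Rightarrow> real \<Rightarrow> bool" where
  "const_germ F x s \<longleftrightarrow>
     (\<exists>e>0. \<exists>r. AE y in lborel. 0 < s * (y - x) \<and> s * (y - x) < e \<longrightarrow> F y = r)"

text \<open>
  The property \<open>P\<close> need not be measurable, hence the detour through a Borel null set that contains
  all points where it fails.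
\<close>
lemma AE_lborel_affine:
  fixes P :: "real \<Rightarrow> bool"
  assumes "c \<noteq> 0" and "AE x in lborel. P x"
  shows "AE x in lborel. P (t + c * x)"
proof -
  obtain N where N: "N \<in> null_sets lborel" "{x \<in> space lborel. \<not> P x} \<subseteq> N"
    using assms(2) by (auto simp: eventually_ae_filter)
  have "Measurable.pred borel (\<lambda>x. x \<notin> N)"
    using N(1) by (auto simp: null_sets_def)
  moreover have "AE x in lborel. x \<notin> N"
    by (rule AE_not_in[OF N(1)])
  ultimately have "AE x in lborel. t + c * x \<notin> N"
    using AE_borel_affine[OF assms(1)] by blast
  then show ?thesis
    by eventually_elim (use N(2) in auto)
qed

text \<open>
  This transports germs along the self-similarity equation. It is used in contrapositive form: a bad
  side of \<open>x\<close> yields a bad side of \<open>t + c * x\<close>.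
\<close>
lemma const_germ_affine:
  assumes "c \<noteq> 0" and "const_germ F (t + c * x) (s / c)"
    and e: "e > 0" "AE y in lborel. 0 < s * (y - x) \<and> s * (y - x) < e \<longrightarrow> H y = b + d * F (t + c * y)"
  shows "const_germ H x s"
proof -
  obtain e' r where e': "e' > 0" and
    r: "AE z in lborel. 0 < s / c * (z - (t + c * x)) \<and> s / c * (z - (t + c * x)) < e' \<longrightarrow> F z = r"
    using assms(2) unfolding const_germ_def by blast
  have scale: "s / c * ((t + c * y) - (t + c * x)) = s * (y - x)" for y
    using \<open>c \<noteq> 0\<close> by (simp add: field_simps)
  have "AE y in lborel. 0 < s * (y - x) \<and> s * (y - x) < min e e' \<longrightarrow> H y = b + d * r"
    using e(2) AE_lborel_affine[OF \<open>c \<noteq> 0\<close> r, of t] unfolding scale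
    by eventually_elim auto
  then show ?thesis
    unfolding const_germ_def using e(1) e' by (intro exI[of _ "min e e'"]) auto
qed

lemma const_germ_right:
  assumes "const_germ F x 1"
  obtains v r where "x < v" "AE y in lborel. x < y \<and> y < v \<longrightarrow> F y = r"
proof -
  obtain e r where "e > 0" "AE y in lborel. 0 < 1 * (y - x) \<and> 1 * (y - x) < e \<longrightarrow> F y = r"
    using assms unfolding const_germ_def by blast
  then show ?thesis
    by (intro that[of "x + e" r]) (auto simp: algebra_simps)
qed

lemma const_germ_left:
  assumes "const_germ F x (- 1)"
  obtains u r where "u < x" "AE y in lborel. u < y \<and> y < x \<longrightarrow> F y = r"
proof -
  obtain e r where "e > 0" "AE y in lborel. 0 < - 1 * (y - x) \<and> - 1 * (y - x) < e \<longrightarrow> F y = r"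
    using assms unfolding const_germ_def by blast
  moreover have "(0 < - 1 * (y - x) \<and> - 1 * (y - x) < e) \<longleftrightarrow> (x - e < y \<and> y < x)" for y
    by auto
  ultimately show ?thesis
    by (intro that[of "x - e" r]) auto
qed

section \<open>A locally constant representative\<close>

definition near_const :: "(real \<Rightarrow> real) \<Rightarrow> real \<Rightarrow> real \<Rightarrow> bool" where
  "near_const F x r \<longleftrightarrow> (\<exists>u v. u < x \<and> x < v \<and> (AE y in lborel. u < y \<and> y < v \<longrightarrow> F y = r))"

definition flat :: "(real \<Rightarrow> real) \<Rightarrow> real set" where
  "flat F = {x. \<exists>r. near_const F x r}"

text \<open>
  By \<open>near_const_unique\<close> below the description denotes the only possible value. The value \<open>0\<close> off
  \<open>flat F\<close> is arbitrary: that set will turn out to be countable.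
\<close>
definition rep :: "(real \<Rightarrow> real) \<Rightarrow> real \<Rightarrow> real" where
  "rep F x = (if x \<in> flat F then THE r. near_const F x r else 0)"

lemma near_const_unique:
  assumes "near_const F x r" "near_const F x s"
  shows "r = s"
proof (rule ccontr)
  assume "r \<noteq> s"
  obtain u v where uv: "u < x" "x < v"
    and r: "AE y in lborel. u < y \<and> y < v \<longrightarrow> F y = r"
    using assms(1) unfolding near_const_def by blast
  obtain u' v' where uv': "u' < x" "x < v'"
    and s: "AE y in lborel. u' < y \<and> y < v' \<longrightarrow> F y = s"
    using assms(2) unfolding near_const_def by blast
  from r s have "AE y in lborel. y \<notin> {max u u'<..<min v v'}"
    by eventually_elim (use \<open>r \<noteq> s\<close> in auto)
  then have "emeasure lborel {max u u'<..<min v v'} = 0"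
    by (subst (asm) AE_iff_null_sets[symmetric]) auto
  then show False
    using uv uv' by (auto simp: min_def max_def split: if_splits)
qed

lemma rep_near_const: "near_const F x r \<Longrightarrow> x \<in> flat F \<and> rep F x = r"
  using near_const_unique by (auto simp: rep_def flat_def intro!: the_equality)

lemma rep_on_interval:
  assumes "AE y in lborel. u < y \<and> y < v \<longrightarrow> F y = r" "u < x" "x < v"
  shows "x \<in> flat F \<and> rep F x = r"
  by (rule rep_near_const) (use assms in \<open>auto simp: near_const_def\<close>)

lemma flatE:
  assumes "x \<in> flat F"
  obtains u v where "u < x" "x < v" "\<forall>y\<in>{u<..<v}. y \<in> flat F \<and> rep F y = rep F x"
proof -
  obtain r u v where *: "u < x" "x < v" "AE y in lborel. u < y \<and> y < v \<longrightarrow> F y = r"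
    using assms unfolding flat_def near_const_def by blast
  show ?thesis
    by (rule that[OF *(1,2)]) (use rep_on_interval[OF *(3)] *(1,2) in auto)
qed

lemma open_flat: "open (flat F)"
proof (subst open_subopen, safe)
  fix x assume "x \<in> flat F"
  then obtain u v where "u < x" "x < v" "\<forall>y\<in>{u<..<v}. y \<in> flat F \<and> rep F y = rep F x"
    by (rule flatE)
  then show "\<exists>T. open T \<and> x \<in> T \<and> T \<subseteq> flat F"
    by (intro exI[of _ "{u<..<v}"]) auto
qed

text \<open>
  Near each point of \<open>flat F\<close> the exceptional set is null. Intervals with rational endpoints suffice
  to see this everywhere, so that only countably many null sets are discarded.
\<close>
lemma AE_rep_on_flat: "AE x in lborel. x \<in> flat F \<longrightarrow> rep F x = F x"
proof -
  have "AE x in lborel. \<forall>q1 q2::rat.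
      (\<exists>r. AE y in lborel. of_rat q1 < y \<and> y < of_rat q2 \<longrightarrow> F y = r) \<and>
        of_rat q1 < x \<and> x < of_rat q2 \<longrightarrow> rep F x = F x"
    unfolding AE_all_countable
  proof (intro allI)
    fix q1 q2 :: rat
    show "AE x in lborel. (\<exists>r. AE y in lborel. of_rat q1 < y \<and> y < of_rat q2 \<longrightarrow> F y = r) \<and>
        of_rat q1 < x \<and> x < of_rat q2 \<longrightarrow> rep F x = F x"
    proof (cases "\<exists>r. AE y in lborel. of_rat q1 < y \<and> y < of_rat q2 \<longrightarrow> F y = r")
      case True
      then obtain r where r: "AE y in lborel. of_rat q1 < y \<and> y < of_rat q2 \<longrightarrow> F y = r"
        by blast
      from r show ?thesis
        by eventually_elim (use rep_on_interval[OF r] in auto)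
    qed auto
  qed
  then show ?thesis
  proof eventually_elim
    fix x
    assume *: "\<forall>q1 q2::rat.
      (\<exists>r. AE y in lborel. of_rat q1 < y \<and> y < of_rat q2 \<longrightarrow> F y = r) \<and>
        of_rat q1 < x \<and> x < of_rat q2 \<longrightarrow> rep F x = F x"
    show "x \<in> flat F \<longrightarrow> rep F x = F x"
    proof
      assume "x \<in> flat F"
      then obtain r u v where uv: "u < x" "x < v" "AE y in lborel. u < y \<and> y < v \<longrightarrow> F y = r"
        unfolding flat_def near_const_def by blast
      obtain q1 q2 :: rat where q: "u < of_rat q1" "of_rat q1 < x" "x < of_rat q2" "of_rat q2 < v"
        using of_rat_dense uv(1,2) by metis
      from uv(3) have "AE y in lborel. of_rat q1 < y \<and> y < of_rat q2 \<longrightarrow> F y = r"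
        by eventually_elim (use q in auto)
      with * q show "rep F x = F x" by blast
    qed
  qed
qed

lemma bounded_component_interval:
  fixes U :: "real set"
  assumes "open U" "bounded U" "C \<in> components U"
  shows "\<exists>u v. u < v \<and> C = {u<..<v}"
proof -
  have "open C" "connected C" "C \<noteq> {}" "bounded C"
    using assms open_components in_components_connected in_components_nonempty
      in_components_subset bounded_subset by metis+
  define u v where "u = Inf C" and "v = Sup C"
  have bdd: "bdd_below C" "bdd_above C"
    using \<open>bounded C\<close> bounded_imp_bdd_below bounded_imp_bdd_above by auto
  have "C = {u<..<v}"
  proof (intro equalityI subsetI)
    fix x assume "x \<in> C"
    then obtain e where e: "e > 0" "ball x e \<subseteq> C"
      using \<open>open C\<close> open_contains_ball by blast
    then have "x - e / 2 \<in> C" "x + e / 2 \<in> C"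
      by (auto simp: subset_iff dist_real_def)
    then have "u \<le> x - e / 2" "x + e / 2 \<le> v"
      unfolding u_def v_def using bdd by (auto intro: cInf_lower cSup_upper)
    then show "x \<in> {u<..<v}" using e by auto
  next
    fix x assume x: "x \<in> {u<..<v}"
    then obtain y z where "y \<in> C" "y < x" "z \<in> C" "x < z"
      using \<open>C \<noteq> {}\<close> bdd by (auto simp: u_def v_def cInf_less_iff less_cSup_iff)
    then show "x \<in> C"
      using \<open>connected C\<close> connectedD_interval[of C y z x] by auto
  qed
  then show ?thesis
    using \<open>C \<noteq> {}\<close> by (intro exI[of _ u] exI[of _ v]) auto
qed

lemma piecewise_constant_countable_range:
  assumes "piecewise_constant g"
  shows "countable (g ` {0..1})"
proof -
  obtain \<I> where I: "countable \<I>" "\<And>I. I \<in> \<I> \<Longrightarrow> g constant_on I" "countable ({0..1} - \<Union>\<I>)"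
    using assms unfolding piecewise_constant_def by blast
  have "countable (g ` I)" if "I \<in> \<I>" for I
  proof -
    have "g constant_on I" by (rule I(2)[OF that])
    then obtain r where "g ` I \<subseteq> {r}" unfolding constant_on_def by blast
    then show ?thesis by (rule countable_subset) simp
  qed
  then have "countable ((\<Union>I\<in>\<I>. g ` I) \<union> g ` ({0..1} - \<Union>\<I>))"
    using I(1,3) by auto
  then show ?thesis
    by (rule countable_subset[rotated]) blast
qed

lemma rep_one_sided:
  assumes germs: "\<And>s. s \<noteq> 0 \<Longrightarrow> const_germ F x s"
  obtains u v l r where "u < x" "x < v"
    "\<forall>y\<in>{u<..<x}. y \<in> flat F \<and> rep F y = l"
    "\<forall>y\<in>{x<..<v}. y \<in> flat F \<and> rep F y = r"
proof -
  have "const_germ F x (- 1)" "const_germ F x 1"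
    by (auto intro: germs)
  from this(1) obtain u l where u: "u < x" "AE y in lborel. u < y \<and> y < x \<longrightarrow> F y = l"
    by (rule const_germ_left)
  from \<open>const_germ F x 1\<close> obtain v r where v: "x < v" "AE y in lborel. x < y \<and> y < v \<longrightarrow> F y = r"
    by (rule const_germ_right)
  show ?thesis
    by (rule that[OF u(1) v(1)]) (use rep_on_interval[OF u(2)] rep_on_interval[OF v(2)] in auto)
qed

text \<open>
  Constant germs on both sides of \<open>x\<close> do not put \<open>x\<close> itself into \<open>flat F\<close>, since the two constants
  may differ; but they put a punctured neighbourhood of \<open>x\<close> there. So the complement of \<open>flat F\<close> is
  discrete away from \<open>c\<close>.
\<close>
lemma countable_not_flat:
  assumes germs: "\<forall>x s. x \<noteq> c \<longrightarrow> s \<noteq> 0 \<longrightarrow> const_germ F x s"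
  shows "countable (- flat F)"
proof -
  have "(- flat F) sparse_in (- {c})"
  proof (subst sparse_in_open)
    show "\<forall>x\<in>- {c}. \<not> x islimpt - flat F"
    proof
      fix x assume "x \<in> - {c}"
      then have "const_germ F x s" if "s \<noteq> 0" for s
        using germs that by simp
      then obtain u v l r where "u < x" "x < v"
        and l: "\<forall>y\<in>{u<..<x}. y \<in> flat F \<and> rep F y = l"
        and r: "\<forall>y\<in>{x<..<v}. y \<in> flat F \<and> rep F y = r"
        by (rule rep_one_sided)
      have "y \<in> flat F" if "y \<in> {u<..<v}" "y \<noteq> x" for y
        using l r that by (cases "y < x") auto
      then show "\<not> x islimpt - flat F"
        using \<open>u < x\<close> \<open>x < v\<close> unfolding islimpt_def
        by (intro notI, drule_tac spec[of _ "{u<..<v}"]) auto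
    qed
  qed auto
  then have "countable (- {c} \<inter> - flat F)"
    by (intro sparse_imp_countable) auto
  then have "countable (insert c (- {c} \<inter> - flat F))"
    by simp
  then show ?thesis
    by (rule countable_subset[rotated]) auto
qed

text \<open>
  The intervals are the components of \<open>flat F \<inter> {0<..<1}\<close>: on a connected set, locally constant
  implies constant.
\<close>
lemma piecewise_constant_rep:
  assumes "countable (- flat F)"
  shows "piecewise_constant (rep F)"
proof -
  define U where "U = flat F \<inter> {0<..<1}"
  have U: "open U" "bounded U"
    unfolding U_def by (auto intro: open_flat bounded_subset[of "{0<..<1::real}"])
  have interval: "I \<subseteq> {0..1} \<and> (\<exists>u v. u < v \<and> I = {u<..<v}) \<and> rep F constant_on I"
    if I: "I \<in> components U" for I
  proof (intro conjI)
    show "I \<subseteq> {0..1}"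
      using in_components_subset[OF I] by (auto simp: U_def)
    show "\<exists>u v. u < v \<and> I = {u<..<v}"
      by (rule bounded_component_interval[OF U I])
    show "rep F constant_on I"
    proof (rule locally_constant_imp_constant[OF in_components_connected[OF I]])
      fix x assume "x \<in> I"
      then have "x \<in> flat F" using in_components_subset[OF I] by (auto simp: U_def)
      then obtain u v where "u < x" "x < v"
        "\<forall>y\<in>{u<..<v}. y \<in> flat F \<and> rep F y = rep F x"
        by (rule flatE)
      then show "\<exists>T. openin (top_of_set I) T \<and> x \<in> T \<and> (\<forall>y\<in>T. rep F y = rep F x)"
        using \<open>x \<in> I\<close>
        by (intro exI[of _ "I \<inter> {u<..<v}"]) (metis IntI Int_iff greaterThanLessThan_iff
            open_greaterThanLessThan openin_open_Int)
    qed
  qed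
  have disj: "disjoint (components U)"
    using pairwise_disjoint_components[of U] by (simp add: pairwise_def disjnt_def)
  have "countable (components U)"
    using disj open_components[OF U(1)] by (intro countable_disjoint_open_subsets) auto
  moreover have "countable ({0..1} - \<Union>(components U))"
  proof -
    have "{0..1} - \<Union>(components U) \<subseteq> insert 0 (insert 1 (- flat F))"
      by (auto simp: U_def)
    then show ?thesis
      by (rule countable_subset) (simp add: assms)
  qed
  ultimately show ?thesis
    unfolding piecewise_constant_def using disj interval by blast
qed

lemma rep_one_sided_limits:
  assumes germs: "\<And>s. s \<noteq> 0 \<Longrightarrow> const_germ F x s"
  shows "(\<exists>l. (rep F \<longlongrightarrow> l) (at_left x)) \<and> (\<exists>r. (rep F \<longlongrightarrow> r) (at_right x))"
proof -
  obtain u v l r where "u < x" "x < v"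
    and l: "\<forall>y\<in>{u<..<x}. y \<in> flat F \<and> rep F y = l"
    and r: "\<forall>y\<in>{x<..<v}. y \<in> flat F \<and> rep F y = r"
    by (rule rep_one_sided[OF germs])
  have "eventually (\<lambda>y. rep F y = l) (at_left x)"
    using \<open>u < x\<close> l by (auto simp: eventually_at_left_field)
  moreover have "eventually (\<lambda>y. rep F y = r) (at_right x)"
    using \<open>x < v\<close> r by (auto simp: eventually_at_right_field)
  ultimately show ?thesis
    by (blast intro: tendsto_eventually)
qed

lemma const_germs_imp_rep:
  assumes germs: "\<forall>x s. x \<noteq> c \<longrightarrow> s \<noteq> 0 \<longrightarrow> const_germ F x s"
  shows "AE x in lborel. rep F x = F x"
    and "piecewise_constant (rep F)"
    and "discontinuity (rep F) x \<Longrightarrow> x = c \<or> discontinuity_first_kind (rep F) x"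
proof -
  have c: "countable (- flat F)"
    by (rule countable_not_flat[OF germs])
  have "AE x in lborel. x \<notin> - flat F"
    using countable_imp_null_set_lborel[OF c] by (rule AE_not_in)
  with AE_rep_on_flat[of F] show "AE x in lborel. rep F x = F x"
    by eventually_elim auto
  show "piecewise_constant (rep F)"
    by (rule piecewise_constant_rep[OF c])
  show "x = c \<or> discontinuity_first_kind (rep F) x" if "discontinuity (rep F) x"
    using that rep_one_sided_limits[of F x] germs unfolding discontinuity_first_kind_def by blast
qed

section \<open>Representatives of a class in \<open>L\<^sub>p\<close>\<close>

text \<open>
  Completeness of Lebesgue measure is what makes \<open>g\<close> measurable here.
\<close>
lemma mem_Lp_cong:
  assumes "mem_Lp p f" "eq_Lp g f"
  shows "mem_Lp p g"
proof -
  have eq: "AE x in lebesgue_on {0..1}. g x = f x" and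
    f: "f \<in> borel_measurable (lebesgue_on {0..1})"
    using assms by (auto simp: eq_Lp_def mem_Lp_def)
  have "(\<lambda>x. if x \<in> {0..1} then f x else 0) \<in> borel_measurable lebesgue"
    using f by (subst borel_measurable_if) auto
  moreover have "AE x in lebesgue. (if x \<in> {0..1} then f x else 0) = (if x \<in> {0..1} then g x else 0)"
    using eq by (subst (asm) AE_restrict_space_iff) (auto elim: eventually_mono)
  ultimately have "(\<lambda>x. if x \<in> {0..1} then g x else 0) \<in> borel_measurable lebesgue"
    by (rule borel_measurable_AE)
  then have g: "g \<in> borel_measurable (lebesgue_on {0..1})"
    by (subst (asm) borel_measurable_if) auto
  show ?thesis
  proof (cases "p = \<infinity>")
    case True
    then obtain C where "AE x in lebesgue_on {0..1}. \<bar>f x\<bar> \<le> C"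
      using assms(1) by (auto simp: mem_Lp_def)
    with eq have "AE x in lebesgue_on {0..1}. \<bar>g x\<bar> \<le> C"
      by eventually_elim auto
    with True g show ?thesis by (auto simp: mem_Lp_def)
  next
    case False
    have "integrable (lebesgue_on {0..1}) (\<lambda>x. \<bar>g x\<bar> powr enn2real p)"
    proof (rule integrable_cong_AE_imp)
      show "integrable (lebesgue_on {0..1}) (\<lambda>x. \<bar>f x\<bar> powr enn2real p)"
        using assms(1) False by (auto simp: mem_Lp_def)
      show "AE x in lebesgue_on {0..1}. \<bar>f x\<bar> powr enn2real p = \<bar>g x\<bar> powr enn2real p"
        using eq by eventually_elim simp
    qed (use g in measurable)
    with False g show ?thesis by (auto simp: mem_Lp_def)
  qed
qed

section \<open>Expanding maps\<close>

text \<open>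
  Iterating \<open>T\<close> would push two distinct points of \<open>B\<close> apart beyond the diameter of \<open>B\<close>.
\<close>
lemma bounded_invariant_set_of_expansion:
  fixes T :: "'a::metric_space \<Rightarrow> 'a"
  assumes "L > 1" and dist: "\<And>x y. dist (T x) (T y) = L * dist x y"
    and inv: "\<And>x. x \<in> B \<Longrightarrow> T x \<in> B" and "bounded B"
    and "x \<in> B" "y \<in> B"
  shows "x = y"
proof (rule ccontr)
  assume "x \<noteq> y"
  have iter: "(T ^^ m) z \<in> B" if "z \<in> B" for z m
    using that inv by (induction m) auto
  have pow: "dist ((T ^^ m) x) ((T ^^ m) y) = L ^ m * dist x y" for m
    by (induction m) (auto simp: dist)
  obtain K where K: "\<And>z w. z \<in> B \<Longrightarrow> w \<in> B \<Longrightarrow> dist z w \<le> K"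
    using \<open>bounded B\<close> unfolding bounded_two_points by blast
  obtain m where "K / dist x y < L ^ m"
    using real_arch_pow[OF \<open>L > 1\<close>] by blast
  then have "K < L ^ m * dist x y"
    using \<open>x \<noteq> y\<close> by (simp add: field_simps)
  moreover have "L ^ m * dist x y \<le> K"
    using K iter assms(5,6) pow by metis
  ultimately show False by simp
qed

section \<open>The similarity operator on the cells of the partition\<close>

lemma last_before_switch:
  assumes "P 1" "\<not> P (n + 1)"
  shows "\<exists>k\<in>{1..n::nat}. P k \<and> \<not> P (k + 1)"
  using assms
proof (induction n)
  case (Suc n)
  show ?case
  proof (cases "P (n + 1)")
    case False
    then show ?thesis using Suc by fastforce
  qed (use Suc.prems in \<open>auto intro!: bexI[of _ "Suc n"]\<close>)
qed auto

text \<open>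
  A one-sided neighbourhood never straddles a breakpoint when it is small enough, even if \<open>x\<close> is a
  breakpoint itself. This is why one-sided germs, and not full neighbourhoods, are followed under the
  expansions.
\<close>
lemma side_in_cell:
  fixes \<alpha> :: "nat \<Rightarrow> real"
  assumes "s \<noteq> 0"
  obtains (cell) e k where "e > 0" "k \<in> {1..n}" "\<alpha> k \<le> x" "x \<le> \<alpha> (k + 1)"
      "\<And>y. 0 < s * (y - x) \<Longrightarrow> s * (y - x) < e \<Longrightarrow> \<alpha> k < y \<and> y < \<alpha> (k + 1)"
  | (outside) e where "e > 0"
      "\<And>y. 0 < s * (y - x) \<Longrightarrow> s * (y - x) < e \<Longrightarrow> y < \<alpha> 1 \<or> \<alpha> (n + 1) < y"
proof (cases "s > 0")
  case True
  have lo: "0 < s * (y - x) \<longleftrightarrow> x < y" for y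
    using True by (simp add: zero_less_mult_iff)
  have hi: "s * (y - x) < s * (w - x) \<longleftrightarrow> y < w" for y w
    using True by simp
  have pos: "s * (w - x) > 0" if "x < w" for w using True that by simp
  consider "x < \<alpha> 1" | "\<alpha> (n + 1) \<le> x" | "\<alpha> 1 \<le> x" "x < \<alpha> (n + 1)" by linarith
  then show ?thesis
  proof cases
    case 1
    \<comment> \<open>The bound on \<open>s * (y - x)\<close> says that \<open>y\<close> has not yet reached the given breakpoint.\<close>
    show ?thesis by (rule outside[of "s * (\<alpha> 1 - x)"]) (use 1 pos in \<open>auto simp only: lo hi\<close>)
  next
    case 2
    show ?thesis by (rule outside[of 1]) (use 2 lo in auto)
  next
    case 3
    then obtain k where k: "k \<in> {1..n}" "\<alpha> k \<le> x" "x < \<alpha> (k + 1)"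
      using last_before_switch[of "\<lambda>k. \<alpha> k \<le> x" n] by (auto simp: not_le)
    show ?thesis
      by (rule cell[of "s * (\<alpha> (k + 1) - x)" k]) (use k pos lo hi in fastforce)+
  qed
next
  case False
  then have neg: "s < 0" using assms by simp
  have lo: "0 < s * (y - x) \<longleftrightarrow> y < x" for y
    using neg by (simp add: zero_less_mult_iff)
  have hi: "s * (y - x) < s * (w - x) \<longleftrightarrow> w < y" for y w
    using neg by simp
  have pos: "s * (w - x) > 0" if "w < x" for w using lo that by simp
  consider "x \<le> \<alpha> 1" | "\<alpha> (n + 1) < x" | "\<alpha> 1 < x" "x \<le> \<alpha> (n + 1)" by linarith
  then show ?thesis
  proof cases
    case 1
    show ?thesis by (rule outside[of 1]) (use 1 lo in auto)
  next
    case 2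
    show ?thesis by (rule outside[of "s * (\<alpha> (n + 1) - x)"]) (use 2 pos in \<open>auto simp only: lo hi\<close>)
  next
    case 3
    then obtain k where k: "k \<in> {1..n}" "\<alpha> k < x" "x \<le> \<alpha> (k + 1)"
      using last_before_switch[of "\<lambda>k. \<alpha> k < x" n] by (auto simp: not_less)
    show ?thesis
      by (rule cell[of "s * (\<alpha> k - x)" k]) (use k pos lo hi in fastforce)+
  qed
qed

definition expansion :: "(nat \<Rightarrow> real) \<Rightarrow> (nat \<Rightarrow> bool) \<Rightarrow> nat \<Rightarrow> real \<Rightarrow> real" where
  "expansion a flip k y =
     (if flip k then (breakpoint a (k + 1) - y) / a k else (y - breakpoint a k) / a k)"

lemma breakpoint_Suc: "1 \<le> k \<Longrightarrow> breakpoint a (k + 1) = breakpoint a k + a k"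
  by (simp add: breakpoint_def atLeastLessThanSuc)

lemma breakpoint_mono:
  assumes "\<forall>k\<in>{1..n}. a k > 0" "i \<le> j" "j \<le> n + 1"
  shows "breakpoint a i \<le> breakpoint a j"
  unfolding breakpoint_def using assms
  by (intro sum_mono2) (auto simp: less_imp_le)

text \<open>
  On an open cell the other summands vanish: the closed cells on which they live meet this one only
  in endpoints.
\<close>
lemma similarity_op_on_cell:
  assumes pos: "\<forall>k\<in>{1..n}. a k > 0" and k: "k \<in> {1..n}"
    and y: "breakpoint a k < y" "y < breakpoint a (k + 1)"
  shows "similarity_op n a d \<beta> flip f y = \<beta> k + d k * f (expansion a flip k y)"
proof -
  have out: "y < breakpoint a l \<or> breakpoint a (l + 1) < y" if "l \<in> {1..n}" "l \<noteq> k" for l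
  proof (cases "l < k")
    case True
    then show ?thesis
      using breakpoint_mono[OF pos, of "l + 1" k] k y by auto
  next
    case False
    then show ?thesis
      using breakpoint_mono[OF pos, of "k + 1" l] that y by auto
  qed
  have "similarity_op n a d \<beta> flip f y = (\<Sum>l\<in>{1..n}. if l = k then \<beta> k + d k * f (expansion a flip k y) else 0)"
    unfolding similarity_op_def
  proof (rule sum.cong)
    fix l assume l: "l \<in> {1..n}"
    show "\<beta> l * indicator {breakpoint a l<..<breakpoint a (l + 1)} y
        + d l * (if flip l then G_rev a l f y else G_pres a l f y)
      = (if l = k then \<beta> k + d k * f (expansion a flip k y) else 0)"
      using y out[OF l] by (auto simp: G_rev_def G_pres_def expansion_def)
  qed simp
  also have "\<dots> = \<beta> k + d k * f (expansion a flip k y)"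
    using k by (simp add: sum.delta)
  finally show ?thesis .
qed

lemma expansion_in_unit:
  assumes "a k > 0" "1 \<le> k" "breakpoint a k < y" "y < breakpoint a (k + 1)"
  shows "expansion a flip k y \<in> {0..1}"
  using assms breakpoint_Suc[of k a] by (auto simp: expansion_def field_simps)

section \<open>At most one bad point\<close>

text \<open>
  The point \<open>c\<close> is the bad point if there is one, and arbitrary otherwise. The set \<open>B\<close> of bad points
  is mapped into itself by the expansion \<open>T\<close> of cell \<open>m\<close>, because on all other cells, and outside
  \<open>[0,1]\<close>, the function \<open>F\<close> is almost everywhere constant.
\<close>
lemma zero_order_const_germs:
  assumes "n > 1" and pos: "\<forall>k\<in>{1..n}. a k > 0" and sum: "(\<Sum>k = 1..n. a k) = 1"
    and invariant: "AE y in lborel. y \<in> {0..1} \<longrightarrow> similarity_op n a d \<beta> flip f y = f y"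
    and m: "m \<in> {1..n}" "\<And>k. k \<in> {1..n} \<Longrightarrow> d k \<noteq> 0 \<Longrightarrow> k = m"
  defines "F \<equiv> \<lambda>x. if x \<in> {0..1} then f x else 0"
  shows "\<exists>c. \<forall>x s. x \<noteq> c \<longrightarrow> s \<noteq> 0 \<longrightarrow> const_germ F x s"
proof -
  define T where "T = expansion a flip m"
  define t where "t = (if flip m then breakpoint a (m + 1) / a m else - breakpoint a m / a m)"
  define q where "q = (if flip m then - 1 / a m else 1 / a m)"
  have T: "T y = t + q * y" for y
    by (simp add: T_def expansion_def t_def q_def diff_divide_distrib)
  \<comment> \<open>As \<open>n > 1\<close>, some other cell has positive length too.\<close>
  have "a m < 1"
  proof -
    obtain l where l: "l \<in> {1..n}" "l \<noteq> m"
      using \<open>n > 1\<close> by (cases "m = 1") (auto intro: that[of 1] that[of n])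
    have "a m < a m + a l" using pos l by auto
    also have "\<dots> = (\<Sum>k\<in>{m, l}. a k)" using l by simp
    also have "\<dots> \<le> (\<Sum>k = 1..n. a k)"
      using pos l m(1) by (intro sum_mono2) (auto simp: less_imp_le)
    finally show ?thesis using sum by simp
  qed
  then have q: "q \<noteq> 0" "\<bar>q\<bar> > 1"
    using bspec[OF pos m(1)] by (auto simp: q_def)
  have bp: "breakpoint a 1 = 0" "breakpoint a (n + 1) = 1"
    using sum by (auto simp: breakpoint_def atLeastLessThanSuc_atLeastAtMost)
  define B where "B = {x. \<exists>s. s \<noteq> 0 \<and> \<not> const_germ F x s}"
  have step: "x \<in> {0..1} \<and> T x \<in> B" if x: "x \<in> B" for x
  proof -
    obtain s where s: "s \<noteq> 0" "\<not> const_germ F x s"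
      using x unfolding B_def by blast
    from s(1) show ?thesis
    proof (cases rule: side_in_cell[where \<alpha> = "breakpoint a" and n = n and x = x])
      case (outside e)
      have "F y = 0" if "0 < s * (y - x)" "s * (y - x) < e" for y
        using outside(2)[OF that] unfolding F_def bp by auto
      then have "AE y in lborel. 0 < s * (y - x) \<and> s * (y - x) < e \<longrightarrow> F y = 0"
        by (intro AE_I2) simp
      then have "const_germ F x s"
        unfolding const_germ_def using \<open>e > 0\<close> by blast
      with s show ?thesis by simp
    next
      case (cell e k)
      have bounds: "0 \<le> breakpoint a k" "breakpoint a (k + 1) \<le> 1"
        using breakpoint_mono[OF pos, of 1 k] breakpoint_mono[OF pos, of "k + 1" "n + 1"] cell(2) bp
        by auto
      have F: "F y = \<beta> k + d k * F (expansion a flip k y)"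
        if "y \<in> {0..1} \<longrightarrow> similarity_op n a d \<beta> flip f y = f y"
          "0 < s * (y - x) \<and> s * (y - x) < e" for y
      proof -
        have y: "breakpoint a k < y" "y < breakpoint a (k + 1)"
          using cell(5)[of y] that by auto
        then show ?thesis
          using similarity_op_on_cell[OF pos cell(2) y] expansion_in_unit[OF _ _ y] that cell(2) pos bounds
          by (auto simp: F_def)
      qed
      have ae: "AE y in lborel. 0 < s * (y - x) \<and> s * (y - x) < e \<longrightarrow>
          F y = \<beta> k + d k * F (expansion a flip k y)"
        using invariant by eventually_elim (use F in blast)
      \<comment> \<open>If \<open>d k = 0\<close>, the equation makes \<open>F\<close> equal to the constant \<open>\<beta> k\<close> on this side of \<open>x\<close>.\<close>
      have "d k \<noteq> 0"
      proof
        assume "d k = 0"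
        with ae have "AE y in lborel. 0 < s * (y - x) \<and> s * (y - x) < e \<longrightarrow> F y = \<beta> k"
          by simp
        with s(2) \<open>e > 0\<close> show False
          unfolding const_germ_def by blast
      qed
      then have "k = m" using m(2) cell(2) by blast
      have ae': "AE y in lborel. 0 < s * (y - x) \<and> s * (y - x) < e \<longrightarrow>
          F y = \<beta> m + d m * F (t + q * y)"
        using ae unfolding \<open>k = m\<close> T_def[symmetric] T .
      have "\<not> const_germ F (t + q * x) (s / q)"
        using const_germ_affine[OF q(1) _ \<open>e > 0\<close> ae'] s(2) by blast
      then have "T x \<in> B"
        using s(1) q(1) unfolding B_def T mem_Collect_eq by (intro exI[of _ "s / q"]) simp
      moreover have "x \<in> {0..1}"
        using bounds cell(3,4) by auto
      ultimately show ?thesis by simp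
    qed
  qed
  have "B \<subseteq> {0..1}"
    using step by blast
  then have "bounded B"
    by (rule bounded_subset[OF bounded_closed_interval])
  have dist_T: "dist (T x) (T y) = \<bar>q\<bar> * dist x y" for x y
    unfolding T dist_real_def abs_mult[symmetric] by (simp add: right_diff_distrib)
  have inv: "T x \<in> B" if "x \<in> B" for x
    using step[OF that] by blast
  have "x = y" if "x \<in> B" "y \<in> B" for x y
    by (rule bounded_invariant_set_of_expansion[OF q(2) dist_T inv \<open>bounded B\<close> that])
  then obtain c where "B \<subseteq> {c}" by blast
  then show ?thesis
    unfolding B_def by blast
qed

section \<open>Self-similar functions of zero spectral order\<close>

theorem theorem2p2:
  fixes p :: ennreal and f :: "real \<Rightarrow> real"
  assumes "1 \<le> p"
    and "self_similar_zero_order p f"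
  shows "\<exists>g. mem_Lp p g \<and> eq_Lp g f \<and> piecewise_constant g \<and> countable (g ` {0..1}) \<and>
           (\<exists>c. \<forall>x. discontinuity g x \<longrightarrow> x = c \<or> discontinuity_first_kind g x)"
proof -
  have AE_unit: "(AE x in lebesgue_on {0..1}. P x) \<longleftrightarrow> (AE x in lborel. x \<in> {0..1} \<longrightarrow> P x)"
    for P :: "real \<Rightarrow> bool"
    by (subst AE_restrict_space_iff) (auto simp: AE_completion_iff)
  obtain n a d \<beta> flip where f: "mem_Lp p f" and par: "similarity_params p n a d \<beta>"
    and eq: "eq_Lp (similarity_op n a d \<beta> flip f) f" and uniq: "\<exists>!k. k \<in> {1..n} \<and> d k \<noteq> 0"
    using assms(2) unfolding self_similar_zero_order_def by blast
  obtain m where m: "m \<in> {1..n}" "\<And>k. k \<in> {1..n} \<Longrightarrow> d k \<noteq> 0 \<Longrightarrow> k = m"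
    using uniq by metis
  define F where "F = (\<lambda>x. if x \<in> {0..1} then f x else 0)"
  have "\<exists>c. \<forall>x s. x \<noteq> c \<longrightarrow> s \<noteq> 0 \<longrightarrow> const_germ F x s"
    unfolding F_def
    by (rule zero_order_const_germs[of n a d \<beta> flip f m])
      (use par eq m in \<open>auto simp: similarity_params_def eq_Lp_def AE_unit\<close>)
  then obtain c where c: "\<forall>x s. x \<noteq> c \<longrightarrow> s \<noteq> 0 \<longrightarrow> const_germ F x s"
    by blast
  have "AE x in lborel. x \<in> {0..1} \<longrightarrow> rep F x = f x"
    using const_germs_imp_rep(1)[OF c] by eventually_elim (auto simp: F_def)
  then have eq': "eq_Lp (rep F) f"
    unfolding eq_Lp_def AE_unit .
  show ?thesis
    using mem_Lp_cong[OF f eq'] eq' const_germs_imp_rep(2,3)[OF c]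
      piecewise_constant_countable_range[OF const_germs_imp_rep(2)[OF c]]
    by blast
qed

end
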